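(* A reduct of a symmetrically indivisible structure to a sub-language is not necessarily symmetrically indivisible. That is, there exist a first-order language $\mathcal{L}$, a sub-language $\mathcal{L}_0\subseteq\mathcal{L}$ and a symmetrically indivisible $\mathcal{L}$-structure $\mathcal{M}$ such that the reduct $\mathcal{M}\upharpoonright\mathcal{L}_0$ is not symmetrically indivisible.
   Context: A substructure $\mathcal{N}\subseteq\mathcal{M}$ is symmetrically embedded in $\mathcal{M}$ if every automorphism of $\mathcal{N}$ extends to an automorphism of $\mathcal{M}$. A structure $\mathcal{M}$ is symmetrically indivisible if for every colouring of its universe in two colours there is a monochromatic substructure $\mathcal{M}'\subseteq\mathcal{M}$ such that $\mathcal{M}'\cong\mathcal{M}$ and $\mathcal{M}'$ is symmetrically embedded in $\mathcal{M}$. *)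

theory Defs
  imports "HOL-Library.FuncSet"
begin

text \<open>First-order languages with function and relation symbols, each of a fixed finite arity;
  constants are function symbols of arity 0.  Equality is always present as a logical symbol.\<close>

record ('f, 'r) fo_language =
  funs :: "'f set"
  rels :: "'r set"
  fun_arity :: "'f \<Rightarrow> nat"
  rel_arity :: "'r \<Rightarrow> nat"

definition sublanguage :: "('f, 'r) fo_language \<Rightarrow> ('f, 'r) fo_language \<Rightarrow> bool" where
  "sublanguage L0 L \<longleftrightarrow>
     funs L0 \<subseteq> funs L \<and> rels L0 \<subseteq> rels L \<and>
     (\<forall>f\<in>funs L0. fun_arity L0 f = fun_arity L f) \<and>
     (\<forall>r\<in>rels L0. rel_arity L0 r = rel_arity L r)"

record ('a, 'f, 'r) fo_structure =
  univ :: "'a set"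
  fun_interp :: "'f \<Rightarrow> 'a list \<Rightarrow> 'a"
  rel_interp :: "'r \<Rightarrow> 'a list \<Rightarrow> bool"

definition tuples :: "('a, 'f, 'r) fo_structure \<Rightarrow> nat \<Rightarrow> 'a list set" where
  "tuples M n = {xs. length xs = n \<and> set xs \<subseteq> univ M}"

text \<open>Only the interpretations of symbols of \<open>L\<close>, at tuples from the universe of the right length,
  are meaningful; all notions below are insensitive to the remaining values.\<close>

definition is_structure :: "('f, 'r) fo_language \<Rightarrow> ('a, 'f, 'r) fo_structure \<Rightarrow> bool" where
  "is_structure L M \<longleftrightarrow>
     univ M \<noteq> {} \<and>
     (\<forall>f\<in>funs L. \<forall>xs\<in>tuples M (fun_arity L f). fun_interp M f xs \<in> univ M)"

definition substructure ::
  "('f, 'r) fo_language \<Rightarrow> ('a, 'f, 'r) fo_structure \<Rightarrow> ('a, 'f, 'r) fo_structure \<Rightarrow> bool" where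
  "substructure L N M \<longleftrightarrow>
     is_structure L N \<and> is_structure L M \<and> univ N \<subseteq> univ M \<and>
     (\<forall>f\<in>funs L. \<forall>xs\<in>tuples N (fun_arity L f). fun_interp N f xs = fun_interp M f xs) \<and>
     (\<forall>r\<in>rels L. \<forall>xs\<in>tuples N (rel_arity L r). rel_interp N r xs = rel_interp M r xs)"

definition isomorphism ::
  "('f, 'r) fo_language \<Rightarrow> ('a, 'f, 'r) fo_structure \<Rightarrow> ('b, 'f, 'r) fo_structure \<Rightarrow>
   ('a \<Rightarrow> 'b) \<Rightarrow> bool" where
  "isomorphism L M N h \<longleftrightarrow>
     bij_betw h (univ M) (univ N) \<and>
     (\<forall>f\<in>funs L. \<forall>xs\<in>tuples M (fun_arity L f).
        h (fun_interp M f xs) = fun_interp N f (map h xs)) \<and>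
     (\<forall>r\<in>rels L. \<forall>xs\<in>tuples M (rel_arity L r).
        rel_interp M r xs = rel_interp N r (map h xs))"

definition isomorphic ::
  "('f, 'r) fo_language \<Rightarrow> ('a, 'f, 'r) fo_structure \<Rightarrow> ('b, 'f, 'r) fo_structure \<Rightarrow> bool" where
  "isomorphic L M N \<longleftrightarrow> (\<exists>h. isomorphism L M N h)"

definition automorphism ::
  "('f, 'r) fo_language \<Rightarrow> ('a, 'f, 'r) fo_structure \<Rightarrow> ('a \<Rightarrow> 'a) \<Rightarrow> bool" where
  "automorphism L M h \<longleftrightarrow> isomorphism L M M h"

definition symmetrically_embedded ::
  "('f, 'r) fo_language \<Rightarrow> ('a, 'f, 'r) fo_structure \<Rightarrow> ('a, 'f, 'r) fo_structure \<Rightarrow> bool" where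
  "symmetrically_embedded L N M \<longleftrightarrow>
     substructure L N M \<and>
     (\<forall>\<sigma>. automorphism L N \<sigma> \<longrightarrow> (\<exists>\<tau>. automorphism L M \<tau> \<and> (\<forall>x\<in>univ N. \<tau> x = \<sigma> x)))"

definition monochromatic :: "('a \<Rightarrow> bool) \<Rightarrow> ('a, 'f, 'r) fo_structure \<Rightarrow> bool" where
  "monochromatic c M \<longleftrightarrow> (\<exists>k. \<forall>x\<in>univ M. c x = k)"

text \<open>A colouring in two colours is a function to \<^typ>\<open>bool\<close>; its values outside the universe
  play no role.\<close>

definition symmetrically_indivisible ::
  "('f, 'r) fo_language \<Rightarrow> ('a, 'f, 'r) fo_structure \<Rightarrow> bool" where
  "symmetrically_indivisible L M \<longleftrightarrow>
     (\<forall>c :: 'a \<Rightarrow> bool. \<exists>M'. substructure L M' M \<and> monochromatic c M' \<and>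
        isomorphic L M' M \<and> symmetrically_embedded L M' M)"

definition reduct ::
  "('f, 'r) fo_language \<Rightarrow> ('a, 'f, 'r) fo_structure \<Rightarrow> ('a, 'f, 'r) fo_structure" where
  "reduct L0 M =
     \<lparr>univ = univ M,
      fun_interp = restrict (fun_interp M) (funs L0),
      rel_interp = restrict (rel_interp M) (rels L0)\<rparr>"

lemma is_structure_reduct:
  assumes "sublanguage L0 L" and "is_structure L M"
  shows "is_structure L0 (reduct L0 M)"
  using assms by (auto simp: sublanguage_def is_structure_def reduct_def tuples_def)

end

theory Submission
  imports Defs "HOL-Library.Infinite_Set" "HOL-Combinatorics.Transposition"
begin

text \<open>Let \<open>R(x,y,z)\<close> say that \<open>x\<close> and \<open>y\<close> are distinct elements below \<open>z\<close>, and take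
  \<open>M = (\<nat>, <, R)\<close>.  Every infinite subset of \<open>\<nat>\<close> carries a copy of \<open>M\<close>, and \<open>M\<close> is rigid, so
  \<open>M\<close> is symmetrically indivisible.  In the reduct \<open>(\<nat>, R)\<close> the elements \<open>0\<close> and \<open>1\<close> can be
  interchanged.  Colour \<open>0\<close> against all other points: a monochromatic copy avoids \<open>0\<close>, hence both
  points \<open>p < q\<close> playing the roles of \<open>0\<close> and \<open>1\<close> lie above \<open>0\<close>, and \<open>R(0,p,q)\<close> prevents an
  automorphism of \<open>(\<nat>, R)\<close> from interchanging them.\<close>

definition below_rel :: "nat \<Rightarrow> nat \<Rightarrow> nat \<Rightarrow> bool" where
  "below_rel x y z \<longleftrightarrow> x \<noteq> y \<and> x < z \<and> y < z"

text \<open>Symbol \<open>0\<close> is the order, symbol \<open>1\<close> is \<open>R\<close>.\<close>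

definition order_below_lang :: "nat set \<Rightarrow> (nat, nat) fo_language" where
  "order_below_lang A =
     \<lparr>funs = {}, rels = A, fun_arity = \<lambda>_. 0, rel_arity = \<lambda>r. if r = 0 then 2 else 3\<rparr>"

definition order_below_struct :: "nat set \<Rightarrow> (nat, nat, nat) fo_structure" where
  "order_below_struct S =
     \<lparr>univ = S, fun_interp = \<lambda>_ _. 0,
      rel_interp = \<lambda>r xs. if r = 0 then xs ! 0 < xs ! 1 else below_rel (xs ! 0) (xs ! 1) (xs ! 2)\<rparr>"

lemma ball_tuples_2:
  "(\<forall>xs\<in>tuples M 2. P xs) \<longleftrightarrow> (\<forall>x\<in>univ M. \<forall>y\<in>univ M. P [x, y])"
  by (auto simp: tuples_def length_Suc_conv numeral_eq_Suc)

lemma ball_tuples_3: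
  "(\<forall>xs\<in>tuples M 3. P xs) \<longleftrightarrow> (\<forall>x\<in>univ M. \<forall>y\<in>univ M. \<forall>z\<in>univ M. P [x, y, z])"
  by (auto simp: tuples_def length_Suc_conv numeral_eq_Suc)

text \<open>\<open>R\<close> is definable from the order and equality, so an injective map that
  preserves and reflects the order also respects \<open>R\<close>.\<close>

lemma isomorphism_order_below:
  "isomorphism (order_below_lang {0, 1}) (order_below_struct S) (order_below_struct T) h \<longleftrightarrow>
     bij_betw h S T \<and> (\<forall>x\<in>S. \<forall>y\<in>S. x < y \<longleftrightarrow> h x < h y)" (is "?L \<longleftrightarrow> ?R")
proof
  assume ?L
  then show ?R
    by (simp add: isomorphism_def order_below_lang_def order_below_struct_def ball_tuples_2)
next
  assume R: ?R
  then have "h x = h y \<longleftrightarrow> x = y" if "x \<in> S" "y \<in> S" for x y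
    using that by (meson bij_betw_imp_inj_on inj_on_eq_iff)
  with R show ?L
    by (simp add: isomorphism_def order_below_lang_def order_below_struct_def
        ball_tuples_2 ball_tuples_3 below_rel_def)
qed

text \<open>A least moved point \<open>x\<close> is impossible: if \<open>\<sigma> x < x\<close>,
  then \<open>\<sigma> x\<close> is fixed, against monotonicity; if \<open>x < \<sigma> x\<close>,
  then the preimage of \<open>x\<close> lies below \<open>x\<close> and is moved.\<close>

lemma order_automorphism_eq_id:
  fixes \<sigma> :: "'a::wellorder \<Rightarrow> 'a"
  assumes bij: "bij_betw \<sigma> S S" and mono: "\<And>x y. x \<in> S \<Longrightarrow> y \<in> S \<Longrightarrow> x < y \<longleftrightarrow> \<sigma> x < \<sigma> y"
    and "x \<in> S"
  shows "\<sigma> x = x"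
  using \<open>x \<in> S\<close>
proof (induction x rule: less_induct)
  case (less x)
  have mem: "\<sigma> x \<in> S" using bij less.prems by (auto simp: bij_betw_def)
  obtain y where y: "y \<in> S" "\<sigma> y = x"
    using bij less.prems by (metis bij_betw_imp_surj_on imageE)
  note IH = less.IH and prems = less.prems
  show ?case
  proof (cases "\<sigma> x" x rule: linorder_cases)
    case less
    with IH[OF less mem] mono[OF mem prems] show ?thesis by simp
  next
    case greater
    with y mono[OF prems y(1)] IH[of y] show ?thesis by (cases y x rule: linorder_cases) auto
  qed simp
qed

lemma symmetrically_indivisible_order_below:
  "symmetrically_indivisible (order_below_lang {0, 1}) (order_below_struct UNIV)"
  unfolding symmetrically_indivisible_def
proof
  fix c :: "nat \<Rightarrow> bool"
  let ?L = "order_below_lang {0, 1}" and ?M = "order_below_struct UNIV"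
  have "\<exists>k. infinite (c -` {k})"
    using inf_img_fin_dom'[of c UNIV] by auto
  then obtain S k where S: "infinite S" and c: "\<forall>x\<in>S. c x = k"
    by blast
  let ?N = "order_below_struct S"
  have univ: "univ ?N = S"
    by (simp add: order_below_struct_def)
  have sub: "substructure ?L ?N ?M"
    using S by (auto simp: substructure_def is_structure_def order_below_lang_def
        order_below_struct_def)
  \<comment> \<open>The increasing enumeration of \<open>S\<close> is an order isomorphism from
    \<nat> onto \<open>S\<close>; its inverse serves here.\<close>
  have "isomorphism ?L ?N ?M (inv_into UNIV (enumerate S))"
    unfolding isomorphism_order_below
  proof (intro conjI ballI)
    show "bij_betw (inv_into UNIV (enumerate S)) S UNIV"
      by (rule bij_betw_inv_into[OF bij_enumerate[OF S]])
    fix x y assume "x \<in> S" "y \<in> S"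
    then obtain i j where "x = enumerate S i" "y = enumerate S j"
      using enumerate_Ex[OF S] by metis
    then show "x < y \<longleftrightarrow> inv_into UNIV (enumerate S) x < inv_into UNIV (enumerate S) y"
      using S bij_enumerate[OF S] by (simp add: bij_betw_def inv_into_f_f)
  qed
  then have iso: "isomorphic ?L ?N ?M"
    by (auto simp: isomorphic_def)
  \<comment> \<open>By rigidity of \<open>?N\<close>, \<open>id\<close> extends every automorphism
    of \<open>?N\<close>.\<close>
  have "automorphism ?L ?M id"
    by (simp add: automorphism_def isomorphism_order_below del: One_nat_def)
  moreover have "\<sigma> x = x" if "automorphism ?L ?N \<sigma>" "x \<in> S" for \<sigma> x
    using that order_automorphism_eq_id[of \<sigma> S x]
    by (simp add: automorphism_def isomorphism_order_below del: One_nat_def)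
  ultimately have "symmetrically_embedded ?L ?N ?M"
    unfolding symmetrically_embedded_def univ using sub by (metis id_apply)
  with sub iso c show "\<exists>M'. substructure ?L M' ?M \<and> monochromatic c M' \<and>
      isomorphic ?L M' ?M \<and> symmetrically_embedded ?L M' ?M"
    unfolding monochromatic_def using univ by blast
qed

text \<open>Two distinct numbers lie below \<open>z\<close> only if \<open>z\<close> is at least 2;
  the swap then fixes \<open>z\<close> and permutes the numbers below it.\<close>

lemma below_rel_transpose_0_1:
  "below_rel (transpose 0 1 x) (transpose 0 1 y) (transpose 0 1 z) \<longleftrightarrow> below_rel x y z"
  by (auto simp: below_rel_def transpose_def)

text \<open>With \<open>M\<close> arbitrary, this covers both the monochromatic copy and the
  automorphisms of the reduct.\<close>

lemma isomorphism_reduct_order_below: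
  "isomorphism (order_below_lang {1}) M (reduct (order_below_lang {1}) (order_below_struct UNIV)) h
     \<longleftrightarrow> bij_betw h (univ M) UNIV \<and>
       (\<forall>x\<in>univ M. \<forall>y\<in>univ M. \<forall>z\<in>univ M.
          rel_interp M 1 [x, y, z] \<longleftrightarrow> below_rel (h x) (h y) (h z))"
  by (simp add: isomorphism_def order_below_lang_def order_below_struct_def reduct_def ball_tuples_3)

lemma not_symmetrically_indivisible_below:
  "\<not> symmetrically_indivisible (order_below_lang {1})
       (reduct (order_below_lang {1}) (order_below_struct UNIV))"
proof
  let ?L = "order_below_lang {1}"
  let ?M = "reduct ?L (order_below_struct UNIV)"
  assume "symmetrically_indivisible ?L ?M"
  then obtain N h where mono: "monochromatic (\<lambda>x. x = 0) N" and iso: "isomorphism ?L N ?M h"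
    and emb: "symmetrically_embedded ?L N ?M"
    unfolding symmetrically_indivisible_def isomorphic_def by meson
  have bij: "bij_betw h (univ N) UNIV"
    and rel: "\<And>x y z. \<lbrakk>x \<in> univ N; y \<in> univ N; z \<in> univ N\<rbrakk> \<Longrightarrow>
      rel_interp N 1 [x, y, z] \<longleftrightarrow> below_rel (h x) (h y) (h z)"
    using iso unfolding isomorphism_reduct_order_below by blast+
  define g where "g = inv_into (univ N) h"
  have g: "g n \<in> univ N" "h (g n) = n" for n
    using bij by (auto simp: g_def bij_betw_def inv_into_into f_inv_into_f)
  \<comment> \<open>The swap of 0 and 1, carried over to \<open>N\<close> along
    \<open>h\<close>.\<close>
  define \<sigma> where "\<sigma> = g \<circ> transpose 0 1 \<circ> h"
  have "bij_betw g UNIV (univ N)"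
    unfolding g_def by (rule bij_betw_inv_into[OF bij])
  then have "bij_betw \<sigma> (univ N) (univ N)"
    unfolding \<sigma>_def by (intro bij_betw_trans[OF bij] bij_betw_trans[OF bij_transpose])
  then have "automorphism ?L N \<sigma>"
    by (simp add: automorphism_def isomorphism_def order_below_lang_def ball_tuples_3 rel \<sigma>_def g
        below_rel_transpose_0_1 del: One_nat_def)
  then obtain \<tau> where \<tau>: "automorphism ?L ?M \<tau>" "\<And>x. x \<in> univ N \<Longrightarrow> \<tau> x = \<sigma> x"
    using emb unfolding symmetrically_embedded_def by meson
  have swap: "\<tau> (g 0) = g 1" "\<tau> (g 1) = g 0"
    using \<tau>(2)[OF g(1)] by (simp_all add: \<sigma>_def g)
  have pres: "below_rel x y z \<longleftrightarrow> below_rel (\<tau> x) (\<tau> y) (\<tau> z)" for x y z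
    using \<tau>(1) unfolding automorphism_def isomorphism_reduct_order_below
    by (simp add: reduct_def order_below_struct_def order_below_lang_def)
  have ne: "g 0 \<noteq> g 1" by (metis g(2) zero_neq_one)
  \<comment> \<open>Distinct points of the same colour: if one were 0, both would be.\<close>
  with mono g(1) have "g 0 \<noteq> 0" "g 1 \<noteq> 0"
    unfolding monochromatic_def by metis+
  \<comment> \<open>As \<open>h\<close> respects only \<open>R\<close>, either of \<open>g 0\<close>
    and \<open>g 1\<close> may be the smaller; each order is refuted by one instance of
    \<open>pres\<close>.\<close>
  with ne swap pres[of 0 "g 0" "g 1"] pres[of 0 "g 1" "g 0"] show False
    by (auto simp: below_rel_def)
qed

theorem theorem3p11:
  "\<exists>(L :: (nat, nat) fo_language) (L0 :: (nat, nat) fo_language)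
     (M :: (nat, nat, nat) fo_structure).
     sublanguage L0 L \<and> is_structure L M \<and> symmetrically_indivisible L M \<and>
     \<not> symmetrically_indivisible L0 (reduct L0 M)"
proof (intro exI conjI)
  show "sublanguage (order_below_lang {1}) (order_below_lang {0, 1})"
    by (simp add: sublanguage_def order_below_lang_def)
  show "is_structure (order_below_lang {0, 1}) (order_below_struct UNIV)"
    by (simp add: is_structure_def order_below_lang_def order_below_struct_def)
qed (fact symmetrically_indivisible_order_below not_symmetrically_indivisible_below)+

end
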